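(* Let $\mathcal{A}$ be a $C^\star$-algebra, let $F_0,F_1,\dots,F_m\in\mathcal{A}$ be selfadjoint, let $f_1,\dots,f_m\in\mathbb{R}$, and let $\mathcal{F}=\operatorname{span}\{F_0,\dots,F_m\}$. Let $\gamma=\{\gamma_1,\dots,\gamma_n\}\subset\mathcal{A}$ be a finite sequence such that $\mathcal{F}\subset Q=\operatorname{span}\{\gamma_i\gamma_j^\star : 1\le i,j\le n\}$, and let $\phi:\mathbb{C}^{n\times n}\to Q$ be the linear map $\phi(M)=\sum_{i,j=1}^n m_{ij}\gamma_i\gamma_j^\star$ for $M=(m_{ij})$. Let $M_{F_0},\dots,M_{F_m}\in\mathbb{C}^{n\times n}$ be any matrices with $\phi(M_{F_i})=F_i$ for $i=0,\dots,m$, and let $K_1,\dots,K_{m_k}\in\mathbb{C}^{n\times n}$ be any matrices with $\operatorname{span}\{K_1,\dots,K_{m_k}\}=\ker(\phi)$. Then the relaxation $$\inf\{\omega(F_0) : \omega\in(\Sigma_2)^\star|_{\mathcal{F}},\ \omega(F_i)\le f_i \ \text{ for all } i\in\{1,\dots,m\}\}$$ can be formulated as the $n\times n$ matrix-valued SDP $$\begin{aligned}\inf\quad & \operatorname{tr}(\rho M_{F_0})\\ \text{subject to}\quad & \operatorname{tr}(\rho M_{F_i})\le f_i && \text{for all } i\in\{1,\dots,m\},\\ & \operatorname{tr}(\rho K_j)=0 && \text{for all } j\in\{1,\dots,m_k\},\\ & \rho\in\mathbb{C}^{n\times n},\ \rho\ge 0,\end{aligned}$$ i.e. the two optimization problems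 have the same value.
   Context: For the sequence $\gamma$, put $V=\operatorname{span}\{\gamma_1,\dots,\gamma_n\}$ (complex span) and $\Sigma_2=\operatorname{conv}\{vv^\star : v\in V\}\subset Q$ (convex hull). The dual cone $(\Sigma_2)^\star$ is the set of linear functionals $\omega:Q\to\mathbb{C}$ with $\omega(s)\ge 0$ for all $s\in\Sigma_2$, and $(\Sigma_2)^\star|_{\mathcal{F}}$ is the set of restrictions of such functionals to $\mathcal{F}$. $\rho\ge0$ means that $\rho$ is Hermitian positive semidefinite. Infima are taken in the extended reals, with the infimum of the empty set equal to $+\infty$. *)

theory Defs
  imports "HOL-Analysis.Analysis" "HOL-Library.Complex_Order"
begin

(* Complex C*-algebras, not necessarily unital. The real vector space structure inherited from
   banach is tied to the complex one by scaleR_scaleC. *)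
class cstar_algebra = real_normed_algebra + banach +
  fixes scaleC :: "complex \<Rightarrow> 'a \<Rightarrow> 'a" (infixr \<open>*\<^sub>C\<close> 75)
    and star :: "'a \<Rightarrow> 'a"
  assumes scaleC_add_right: "a *\<^sub>C (x + y) = a *\<^sub>C x + a *\<^sub>C y"
    and scaleC_add_left: "(a + b) *\<^sub>C x = a *\<^sub>C x + b *\<^sub>C x"
    and scaleC_scaleC: "a *\<^sub>C (b *\<^sub>C x) = (a * b) *\<^sub>C x"
    and scaleC_one: "1 *\<^sub>C x = x"
    and scaleR_scaleC: "r *\<^sub>R x = complex_of_real r *\<^sub>C x"
    and mult_scaleC_left: "(a *\<^sub>C x) * y = a *\<^sub>C (x * y)"
    and mult_scaleC_right: "x * (a *\<^sub>C y) = a *\<^sub>C (x * y)"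
    and norm_scaleC: "norm (a *\<^sub>C x) = cmod a * norm x"
    and star_star: "star (star x) = x"
    and star_add: "star (x + y) = star x + star y"
    and star_scaleC: "star (a *\<^sub>C x) = cnj a *\<^sub>C star x"
    and star_mult: "star (x * y) = star y * star x"
    and cstar_identity: "norm (star x * x) = (norm x)\<^sup>2"

global_interpretation complex_vector: vector_space
  "scaleC :: complex \<Rightarrow> 'a::cstar_algebra \<Rightarrow> 'a"
  by unfold_locales
    (simp_all add: scaleC_add_right scaleC_add_left scaleC_scaleC scaleC_one)

(* Entrywise scaling: makes complex^'n^'m a complex vector space, so that the complex span of a
   set of matrices is available. *)
definition mat_scale :: "complex \<Rightarrow> complex^'n^'m \<Rightarrow> complex^'n^'m" where
  "mat_scale c M = (\<chi> i j. c * M $ i $ j)"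

global_interpretation complex_matrix: vector_space
  "mat_scale :: complex \<Rightarrow> complex^'n^'m \<Rightarrow> complex^'n^'m"
  by unfold_locales (simp_all add: mat_scale_def vec_eq_iff algebra_simps)

definition Q_span :: "('n::finite \<Rightarrow> 'a::cstar_algebra) \<Rightarrow> 'a set" where
  "Q_span \<gamma> = complex_vector.span {\<gamma> i * star (\<gamma> j) | i j. True}"

definition Sigma2 :: "('n::finite \<Rightarrow> 'a::cstar_algebra) \<Rightarrow> 'a set" where
  "Sigma2 \<gamma> = convex hull {v * star v | v. v \<in> complex_vector.span (range \<gamma>)}"

definition phi :: "('n::finite \<Rightarrow> 'a::cstar_algebra) \<Rightarrow> complex^'n^'n \<Rightarrow> 'a" where
  "phi \<gamma> M = (\<Sum>i\<in>UNIV. \<Sum>j\<in>UNIV. M $ i $ j *\<^sub>C (\<gamma> i * star (\<gamma> j)))"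

(* Functionals on Q are represented by functions that are undefined outside Q.
   In the order on complex, 0 <= z means that z is real and nonnegative. *)
definition dual_cone :: "'a::cstar_algebra set \<Rightarrow> 'a set \<Rightarrow> ('a \<Rightarrow> complex) set" where
  "dual_cone Q S = {\<omega> \<in> extensional Q.
     (\<forall>x\<in>Q. \<forall>y\<in>Q. \<omega> (x + y) = \<omega> x + \<omega> y) \<and>
     (\<forall>c. \<forall>x\<in>Q. \<omega> (c *\<^sub>C x) = c * \<omega> x) \<and>
     (\<forall>s\<in>S. 0 \<le> \<omega> s)}"

definition hermitian :: "complex^'n^'n \<Rightarrow> bool" where
  "hermitian A \<longleftrightarrow> (\<forall>i j. A $ i $ j = cnj (A $ j $ i))"

definition psd :: "complex^'n^'n \<Rightarrow> bool" where
  "psd A \<longleftrightarrow> hermitian A \<and> (\<forall>x. 0 \<le> (\<Sum>i\<in>UNIV. cnj (x $ i) * (A *v x) $ i))"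

end

theory Submission
  imports Defs
begin

text \<open>
  Both problems have not only the same infimum but literally the same set of objective values.

  Write $L_\rho(A) = \mathrm{tr}(\rho A)$. Every linear functional on the matrix space is $L_\rho$
  for some $\rho$ (\<open>linear_functional_eq_trace\<close>). Because \<open>phi \<gamma>\<close> maps the matrix space onto
  $Q$ (\<open>range_phi\<close>), functionals on $Q$ pull back along \<open>phi \<gamma>\<close> exactly to those $L_\rho$ that vanish
  on the kernel of \<open>phi \<gamma>\<close>, and this vanishing can be tested on the spanning matrices $K_j$.

  Under this identification positivity on $\Sigma_2$ becomes positive semidefiniteness of $\rho$:
  a generator $v v^\star$ with $v = \sum_i x_i \gamma_i$ is the image under \<open>phi \<gamma>\<close> of the rank one
  matrix $x x^\star$ (\<open>phi_outer\<close>), and $L_\rho(x x^\star) = x^\star \rho x$ (\<open>trace_outer\<close>). The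
  convex hull adds no condition, since a half space is convex. The two directions of the
  correspondence are \<open>dual_cone_imp_psd\<close> and \<open>psd_imp_dual_cone\<close>. Finally, if
  $\omega \circ \phi = L_\rho$ then $\omega(F_i) = \mathrm{tr}(\rho M_{F_i})$ for whichever matrix
  $M_{F_i}$ represents $F_i$, so constraints and objectives match.
\<close>

section \<open>Linear functionals and quadratic forms on complex matrices\<close>

lemma trace_mult: "trace (A ** B) = (\<Sum>i\<in>UNIV. \<Sum>j\<in>UNIV. A $ i $ j * B $ j $ i)"
  by (simp add: trace_def matrix_matrix_mult_def)

lemma trace_mult_add_right:
  fixes A B C :: "complex^'n^'n"
  shows "trace (A ** (B + C)) = trace (A ** B) + trace (A ** C)"
  by (simp add: matrix_add_ldistrib trace_add)

lemma trace_mult_mat_scale_right: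
  fixes A B :: "complex^'n^'n"
  shows "trace (A ** mat_scale c B) = c * trace (A ** B)"
  by (simp add: trace_mult mat_scale_def sum_distrib_left mult_ac)

lemma trace_mult_eq_0_on_span:
  fixes A B :: "complex^'n^'n"
  assumes "B \<in> complex_matrix.span S" and "\<And>C. C \<in> S \<Longrightarrow> trace (A ** C) = 0"
  shows "trace (A ** B) = 0"
proof -
  have "trace (A ** 0) = 0"
    by (simp add: trace_def)
  then have "complex_matrix.subspace {B. trace (A ** B) = 0}"
    by (intro complex_matrix.subspaceI)
      (simp_all add: trace_mult_add_right trace_mult_mat_scale_right)
  then have "complex_matrix.span S \<subseteq> {B. trace (A ** B) = 0}"
    using assms(2) by (intro complex_matrix.span_minimal) auto
  then show ?thesis
    using assms(1) by auto
qed

text \<open>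
  The representing matrix is the transposed table of values of the functional on the matrix units.
\<close>

lemma linear_functional_eq_trace:
  fixes L :: "complex^'n^'n \<Rightarrow> complex"
  assumes add: "\<And>A B. L (A + B) = L A + L B"
    and scale: "\<And>c A. L (mat_scale c A) = c * L A"
  shows "\<exists>\<rho>. \<forall>A. L A = trace (\<rho> ** A)"
proof (intro exI allI)
  define E :: "'n \<Rightarrow> 'n \<Rightarrow> complex^'n^'n"
    where "E = (\<lambda>i j. \<chi> k l. if k = i \<and> l = j then 1 else 0)"
  fix A :: "complex^'n^'n"
  have L0: "L 0 = 0"
    using add[of 0 0] by simp
  have L_sum: "L (sum g S) = (\<Sum>s\<in>S. L (g s))" for g :: "'n \<Rightarrow> complex^'n^'n" and S
    by (induction S rule: infinite_finite_induct) (simp_all add: L0 add)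
  have "(\<Sum>i\<in>UNIV. \<Sum>j\<in>UNIV. A $ i $ j * (if k = i \<and> l = j then 1 else 0)) = A $ k $ l" for k l
  proof -
    have "(\<Sum>j\<in>UNIV. A $ i $ j * (if k = i \<and> l = j then 1 else 0))
        = (if k = i then A $ i $ l else 0)" for i
      by (simp add: if_distrib[of "\<lambda>x. _ * x"] cong: if_cong)
    then show ?thesis
      by simp
  qed
  then have "A = (\<Sum>i\<in>UNIV. \<Sum>j\<in>UNIV. mat_scale (A $ i $ j) (E i j))"
    by (simp add: vec_eq_iff mat_scale_def E_def)
  then have "L A = L (\<Sum>i\<in>UNIV. \<Sum>j\<in>UNIV. mat_scale (A $ i $ j) (E i j))"
    by simp
  also have "\<dots> = (\<Sum>i\<in>UNIV. \<Sum>j\<in>UNIV. A $ i $ j * L (E i j))"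
    by (simp add: L_sum scale)
  also have "\<dots> = (\<Sum>j\<in>UNIV. \<Sum>i\<in>UNIV. A $ i $ j * L (E i j))"
    by (rule sum.swap)
  also have "\<dots> = trace ((\<chi> j i. L (E i j)) ** A)"
    by (simp add: trace_mult mult.commute)
  finally show "L A = trace ((\<chi> j i. L (E i j)) ** A)" .
qed

definition outer :: "complex^'n \<Rightarrow> complex^'n^'n" where
  "outer x = (\<chi> i j. x $ i * cnj (x $ j))"

lemma trace_outer:
  "trace (A ** outer x) = (\<Sum>i\<in>UNIV. cnj (x $ i) * (A *v x) $ i)"
  by (simp add: trace_mult outer_def matrix_vector_mult_def sum_distrib_left mult_ac)

text \<open>
  This is polarization over the complex numbers. It turns positivity on rank one matrices, the only
  information that a functional positive on $\Sigma_2$ carries, into Hermitian symmetry of the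
  representing matrix.
\<close>

lemma hermitian_if_quadratic_form_real:
  fixes A :: "complex^'n^'n"
  assumes "\<And>x. (\<Sum>i\<in>UNIV. cnj (x $ i) * (A *v x) $ i) \<in> \<real>"
  shows "hermitian A"
  unfolding hermitian_def
proof (intro allI)
  fix i j
  have delta: "(\<Sum>k\<in>UNIV. cnj (axis l 1 $ k) * g k) = g l" for l :: 'n and g :: "'n \<Rightarrow> complex"
    by (simp add: axis_def if_distrib[of cnj] if_distrib[of "\<lambda>x. x * _"] cong: if_cong)
  have column: "(A *v axis l 1) $ k = A $ k $ l" for k l
    by (simp add: matrix_vector_mult_def axis_def if_distrib[of "\<lambda>x. _ * x"] cong: if_cong)
  have diag: "A $ k $ k \<in> \<real>" for k
    using assms[of "axis k 1"] by (simp add: delta column)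
  \<comment> \<open>The form at \<open>e\<^sub>i + c e\<^sub>j\<close> isolates the combination \<open>c A\<^sub>i\<^sub>j + cnj c A\<^sub>j\<^sub>i\<close>; taking \<open>c = 1\<close> and
    \<open>c = \<i>\<close> determines the imaginary and the real part of \<open>A\<^sub>i\<^sub>j - cnj A\<^sub>j\<^sub>i\<close>.\<close>
  have cross: "c * A $ i $ j + cnj c * A $ j $ i \<in> \<real>" for c
  proof -
    let ?x = "axis i 1 + c *s axis j 1"
    have "(\<Sum>k\<in>UNIV. cnj (?x $ k) * (A *v ?x) $ k)
        = (\<Sum>k\<in>UNIV. cnj (axis i 1 $ k) * (A *v ?x) $ k)
          + cnj c * (\<Sum>k\<in>UNIV. cnj (axis j 1 $ k) * (A *v ?x) $ k)"
      by (simp add: sum_distrib_left sum.distrib algebra_simps)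
    also have "\<dots> = (A *v ?x) $ i + cnj c * (A *v ?x) $ j"
      by (simp only: delta)
    also have "\<dots> = A $ i $ i + (c * A $ i $ j + cnj c * A $ j $ i) + (c * cnj c) * A $ j $ j"
      by (simp add: matrix_vector_right_distrib vector_scalar_commute column
          algebra_simps)
    finally have "A $ i $ i + (c * A $ i $ j + cnj c * A $ j $ i) + (c * cnj c) * A $ j $ j \<in> \<real>"
      using assms[of ?x] by simp
    then show ?thesis
      using diag[of i] diag[of j] by (simp add: complex_is_Real_iff algebra_simps)
  qed
  show "A $ i $ j = cnj (A $ j $ i)"
    using cross[of 1] cross[of \<i>] by (simp add: complex_is_Real_iff complex_eq_iff)
qed

lemma psd_iff_trace_outer:
  fixes A :: "complex^'n^'n"
  shows "psd A \<longleftrightarrow> (\<forall>x. 0 \<le> trace (A ** outer x))"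
  unfolding psd_def trace_outer
  by (auto intro!: hermitian_if_quadratic_form_real nonnegative_complex_is_real)

section \<open>The representation map\<close>

lemma phi_add: "phi \<gamma> (A + B) = phi \<gamma> A + phi \<gamma> B"
  by (simp add: phi_def scaleC_add_left sum.distrib)

lemma phi_mat_scale: "phi \<gamma> (mat_scale c A) = c *\<^sub>C phi \<gamma> A"
  by (simp add: phi_def mat_scale_def complex_vector.scale_sum_right)

lemma phi_diff: "phi \<gamma> (A - B) = phi \<gamma> A - phi \<gamma> B"
  using phi_add[of \<gamma> "A - B" B] by simp

lemma subspace_range_phi: "complex_vector.subspace (range (phi \<gamma>))"
proof (rule complex_vector.subspaceI)
  show "0 \<in> range (phi \<gamma>)"
    using phi_diff[of \<gamma> 0 0] by (intro range_eqI[of _ _ 0]) simp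
qed (auto simp: phi_add[symmetric] phi_mat_scale[symmetric])

lemma range_phi: "range (phi \<gamma>) = Q_span \<gamma>"
proof
  have "phi \<gamma> A \<in> Q_span \<gamma>" for A
    unfolding phi_def Q_span_def
    by (intro complex_vector.span_sum complex_vector.span_scale complex_vector.span_base) auto
  then show "range (phi \<gamma>) \<subseteq> Q_span \<gamma>"
    by auto
next
  have "\<gamma> i * star (\<gamma> j) = phi \<gamma> (\<chi> k l. if k = i \<and> l = j then 1 else 0)" for i j
  proof -
    have "(\<Sum>l\<in>UNIV. (if k = i \<and> l = j then 1 else 0) *\<^sub>C (\<gamma> k * star (\<gamma> l)))
        = (if k = i then \<gamma> k * star (\<gamma> j) else 0)" for k
      by (simp add: if_distrib[of "\<lambda>x. x *\<^sub>C _"] cong: if_cong)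
    then show ?thesis
      by (simp add: phi_def)
  qed
  then show "Q_span \<gamma> \<subseteq> range (phi \<gamma>)"
    unfolding Q_span_def
    by (intro complex_vector.span_minimal subspace_range_phi) auto
qed

lemma star_sum: "star (sum g S) = (\<Sum>s\<in>S. star (g s))"
proof -
  have "star 0 = (0::'a)"
    using star_add[of "0::'a" 0] by simp
  then show ?thesis
    by (induction S rule: infinite_finite_induct) (simp_all add: star_add)
qed

lemma phi_outer:
  "phi \<gamma> (outer x) = (\<Sum>i\<in>UNIV. x $ i *\<^sub>C \<gamma> i) * star (\<Sum>i\<in>UNIV. x $ i *\<^sub>C \<gamma> i)"
  by (simp add: phi_def outer_def star_sum star_scaleC sum_product mult_scaleC_left
      mult_scaleC_right mult.commute)

lemma span_range_eq:
  fixes \<gamma> :: "'n::finite \<Rightarrow> 'a::cstar_algebra"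
  shows "complex_vector.span (range \<gamma>) = range (\<lambda>x :: complex^'n. \<Sum>i\<in>UNIV. x $ i *\<^sub>C \<gamma> i)"
    (is "_ = range ?c")
proof
  have "complex_vector.subspace (range ?c)"
  proof (rule complex_vector.subspaceI)
    show "0 \<in> range ?c"
      by (rule range_eqI[of _ _ 0]) simp
  next
    fix v w
    assume "v \<in> range ?c" "w \<in> range ?c"
    then obtain x y where "v = ?c x" "w = ?c y"
      by auto
    then have "v + w = ?c (x + y)"
      by (simp add: scaleC_add_left sum.distrib)
    then show "v + w \<in> range ?c"
      by blast
  next
    fix a v
    assume "v \<in> range ?c"
    then obtain x where "v = ?c x"
      by auto
    then have "a *\<^sub>C v = ?c (a *s x)"
      by (simp add: complex_vector.scale_sum_right)
    then show "a *\<^sub>C v \<in> range ?c"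
      by blast
  qed
  moreover have "\<gamma> i = ?c (axis i 1)" for i
    by (simp add: axis_def if_distrib[of "\<lambda>x. x *\<^sub>C _"] cong: if_cong)
  then have "range \<gamma> \<subseteq> range ?c"
    by blast
  ultimately show "complex_vector.span (range \<gamma>) \<subseteq> range ?c"
    by (rule complex_vector.span_minimal[rotated])
next
  show "range ?c \<subseteq> complex_vector.span (range \<gamma>)"
    by (intro image_subsetI complex_vector.span_sum complex_vector.span_scale
        complex_vector.span_base) auto
qed

lemma Sigma2_eq: "Sigma2 \<gamma> = convex hull range (\<lambda>x. phi \<gamma> (outer x))"
proof -
  have "{v * star v | v. v \<in> complex_vector.span (range \<gamma>)} = range (\<lambda>x. phi \<gamma> (outer x))"
    by (auto simp: span_range_eq phi_outer)
  then show ?thesis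
    by (simp add: Sigma2_def)
qed

section \<open>Positive functionals and positive semidefinite matrices\<close>

lemma dual_cone_imp_psd:
  assumes "\<omega> \<in> dual_cone (Q_span \<gamma>) (Sigma2 \<gamma>)"
  shows "\<exists>\<rho>. psd \<rho> \<and> (\<forall>A. \<omega> (phi \<gamma> A) = trace (\<rho> ** A))"
proof -
  have Q: "phi \<gamma> A \<in> Q_span \<gamma>" for A
    using range_phi[of \<gamma>] by auto
  have "\<omega> (phi \<gamma> (A + B)) = \<omega> (phi \<gamma> A) + \<omega> (phi \<gamma> B)" for A B
    using assms Q by (simp add: phi_add dual_cone_def)
  moreover have "\<omega> (phi \<gamma> (mat_scale c A)) = c * \<omega> (phi \<gamma> A)" for c A
    using assms Q by (simp add: phi_mat_scale dual_cone_def)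
  ultimately obtain \<rho> where \<rho>: "\<And>A. \<omega> (phi \<gamma> A) = trace (\<rho> ** A)"
    using linear_functional_eq_trace[of "\<lambda>A. \<omega> (phi \<gamma> A)"] by blast
  have "phi \<gamma> (outer x) \<in> Sigma2 \<gamma>" for x
    unfolding Sigma2_eq by (rule hull_inc) auto
  then have "psd \<rho>"
    using assms by (simp add: psd_iff_trace_outer \<rho>[symmetric] dual_cone_def)
  with \<rho> show ?thesis
    by blast
qed

text \<open>
  Vanishing on the kernel is exactly what lets the trace functional descend along \<open>phi \<gamma>\<close>: its
  value does not depend on the matrix chosen to represent an element of $Q$.
\<close>

lemma psd_imp_dual_cone:
  assumes "psd \<rho>" and ker: "\<And>A. phi \<gamma> A = 0 \<Longrightarrow> trace (\<rho> ** A) = 0"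
  shows "\<exists>\<omega> \<in> dual_cone (Q_span \<gamma>) (Sigma2 \<gamma>). \<forall>A. \<omega> (phi \<gamma> A) = trace (\<rho> ** A)"
proof -
  define \<omega> where "\<omega> = restrict (\<lambda>q. trace (\<rho> ** (SOME A. phi \<gamma> A = q))) (Q_span \<gamma>)"
  have well_defined: "trace (\<rho> ** A) = trace (\<rho> ** B)" if "phi \<gamma> A = phi \<gamma> B" for A B
    using ker[of "A - B"] that trace_mult_add_right[of \<rho> "A - B" B] by (simp add: phi_diff)
  have \<omega>: "\<omega> (phi \<gamma> A) = trace (\<rho> ** A)" for A
  proof -
    have "trace (\<rho> ** (SOME B. phi \<gamma> B = phi \<gamma> A)) = trace (\<rho> ** A)"
      by (rule well_defined, rule someI[of _ A]) simp
    moreover have "phi \<gamma> A \<in> Q_span \<gamma>"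
      using range_phi[of \<gamma>] by auto
    ultimately show ?thesis
      by (simp add: \<omega>_def)
  qed
  have add: "\<omega> (x + y) = \<omega> x + \<omega> y" if "x \<in> Q_span \<gamma>" "y \<in> Q_span \<gamma>" for x y
    using that unfolding range_phi[symmetric]
    by (auto simp: phi_add[symmetric] \<omega> trace_mult_add_right)
  have scale: "\<omega> (c *\<^sub>C x) = c * \<omega> x" if "x \<in> Q_span \<gamma>" for c x
    using that unfolding range_phi[symmetric]
    by (auto simp: phi_mat_scale[symmetric] \<omega> trace_mult_mat_scale_right)
  have "convex {s \<in> Q_span \<gamma>. 0 \<le> \<omega> s}"
  proof (rule convexI)
    fix x y and u v :: real
    assume xy: "x \<in> {s \<in> Q_span \<gamma>. 0 \<le> \<omega> s}" "y \<in> {s \<in> Q_span \<gamma>. 0 \<le> \<omega> s}"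
      and uv: "0 \<le> u" "0 \<le> v"
    have mem: "complex_of_real r *\<^sub>C z \<in> Q_span \<gamma>" if "z \<in> Q_span \<gamma>" for r z
      using that unfolding Q_span_def by (rule complex_vector.span_scale)
    have "\<omega> (u *\<^sub>R x + v *\<^sub>R y) = complex_of_real u * \<omega> x + complex_of_real v * \<omega> y"
      using xy by (simp add: scaleR_scaleC add scale mem)
    moreover have "u *\<^sub>R x + v *\<^sub>R y \<in> Q_span \<gamma>"
      using xy mem unfolding scaleR_scaleC Q_span_def
      by (intro complex_vector.span_add) auto
    ultimately show "u *\<^sub>R x + v *\<^sub>R y \<in> {s \<in> Q_span \<gamma>. 0 \<le> \<omega> s}"
      using xy uv by (simp add: less_eq_complex_def)
  qed
  moreover have "range (\<lambda>x. phi \<gamma> (outer x)) \<subseteq> {s \<in> Q_span \<gamma>. 0 \<le> \<omega> s}"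
    using assms(1) unfolding range_phi[symmetric] by (auto simp: \<omega> psd_iff_trace_outer)
  ultimately have "Sigma2 \<gamma> \<subseteq> {s \<in> Q_span \<gamma>. 0 \<le> \<omega> s}"
    unfolding Sigma2_eq by (intro hull_minimal)
  moreover have "\<omega> \<in> extensional (Q_span \<gamma>)"
    by (simp add: \<omega>_def)
  ultimately have "\<omega> \<in> dual_cone (Q_span \<gamma>) (Sigma2 \<gamma>)"
    using add scale by (auto simp: dual_cone_def)
  then show ?thesis
    using \<omega> by blast
qed

section \<open>Equality of the optimal values\<close>

(* Both objectives are complex-valued by type but real at every feasible point, because F 0 is
   selfadjoint; Re only performs the coercion to the extended reals. *)
theorem theorem7:
  fixes F :: "nat \<Rightarrow> 'a::cstar_algebra" and f :: "nat \<Rightarrow> real" and m :: nat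
    and \<gamma> :: "'n::finite \<Rightarrow> 'a"
    and M K :: "nat \<Rightarrow> complex^'n^'n" and mk :: nat
  assumes "\<And>i. i \<le> m \<Longrightarrow> star (F i) = F i"
    and "complex_vector.span (F ` {0..m}) \<subseteq> Q_span \<gamma>"
    and "\<And>i. i \<le> m \<Longrightarrow> phi \<gamma> (M i) = F i"
    and "complex_matrix.span (K ` {1..mk}) = {A. phi \<gamma> A = 0}"
  shows "(INF \<omega> \<in> {\<omega> \<in> (\<lambda>\<omega>. restrict \<omega> (complex_vector.span (F ` {0..m}))) `
                          dual_cone (Q_span \<gamma>) (Sigma2 \<gamma>).
                    \<forall>i\<in>{1..m}. \<omega> (F i) \<le> complex_of_real (f i)}.
            ereal (Re (\<omega> (F 0))))
       = (INF \<rho> \<in> {\<rho>. (\<forall>i\<in>{1..m}. trace (\<rho> ** M i) \<le> complex_of_real (f i)) \<and>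
                      (\<forall>j\<in>{1..mk}. trace (\<rho> ** K j) = 0) \<and>
                      psd \<rho>}.
            ereal (Re (trace (\<rho> ** M 0))))"
proof -
  let ?S = "complex_vector.span (F ` {0..m})"
  let ?D = "dual_cone (Q_span \<gamma>) (Sigma2 \<gamma>)"
  let ?lhs = "{\<omega> \<in> (\<lambda>\<omega>. restrict \<omega> ?S) ` ?D. \<forall>i\<in>{1..m}. \<omega> (F i) \<le> complex_of_real (f i)}"
  let ?rhs = "{\<rho>. (\<forall>i\<in>{1..m}. trace (\<rho> ** M i) \<le> complex_of_real (f i)) \<and>
                  (\<forall>j\<in>{1..mk}. trace (\<rho> ** K j) = 0) \<and> psd \<rho>}"
  have F_mem: "F i \<in> ?S" if "i \<le> m" for i
    using that by (intro complex_vector.span_base) auto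
  have agree: "restrict \<omega> ?S (F i) = trace (\<rho> ** M i)"
    if "\<And>A. \<omega> (phi \<gamma> A) = trace (\<rho> ** A)" "i \<le> m" for \<omega> \<rho> i
    using that(1)[of "M i"] that(2) assms(3) F_mem by simp
  have "(\<lambda>\<omega>. ereal (Re (\<omega> (F 0)))) ` ?lhs = (\<lambda>\<rho>. ereal (Re (trace (\<rho> ** M 0)))) ` ?rhs"
    (is "?f ` _ = ?g ` _")
  proof (intro equalityI subsetI)
    fix z
    assume "z \<in> ?f ` ?lhs"
    then obtain \<omega> where \<omega>: "\<omega> \<in> ?D" "z = ?f (restrict \<omega> ?S)"
        "\<forall>i\<in>{1..m}. restrict \<omega> ?S (F i) \<le> complex_of_real (f i)"
      by auto
    obtain \<rho> where "psd \<rho>" and \<rho>: "\<And>A. \<omega> (phi \<gamma> A) = trace (\<rho> ** A)"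
      using dual_cone_imp_psd[OF \<omega>(1)] by blast
    have "trace (\<rho> ** K j) = 0" if "j \<in> {1..mk}" for j
    proof -
      have "K j \<in> complex_matrix.span (K ` {1..mk})"
        using that by (intro complex_matrix.span_base) auto
      then have "phi \<gamma> (K j) = phi \<gamma> 0"
        using assms(4) phi_diff[of \<gamma> 0 0] by simp
      then have "trace (\<rho> ** K j) = trace (\<rho> ** 0)"
        by (metis \<rho>)
      then show ?thesis
        by (simp add: trace_def)
    qed
    moreover have "trace (\<rho> ** M i) \<le> complex_of_real (f i)" if "i \<in> {1..m}" for i
      using \<omega>(3) that agree[OF \<rho>, of i] by (metis atLeastAtMost_iff)
    ultimately have "\<rho> \<in> ?rhs"
      using \<open>psd \<rho>\<close> by blast
    moreover have "z = ?g \<rho>"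
      using \<omega>(2) agree[OF \<rho>, of 0] by simp
    ultimately show "z \<in> ?g ` ?rhs"
      by blast
  next
    fix z
    assume "z \<in> ?g ` ?rhs"
    then obtain \<rho> where \<rho>: "\<rho> \<in> ?rhs" "z = ?g \<rho>"
      by blast
    have "trace (\<rho> ** A) = 0" if "phi \<gamma> A = 0" for A
    proof (rule trace_mult_eq_0_on_span)
      show "A \<in> complex_matrix.span (K ` {1..mk})"
        using assms(4) that by simp
      show "trace (\<rho> ** C) = 0" if "C \<in> K ` {1..mk}" for C
        using \<rho>(1) that by auto
    qed
    then obtain \<omega> where "\<omega> \<in> ?D" and \<omega>: "\<And>A. \<omega> (phi \<gamma> A) = trace (\<rho> ** A)"
      using psd_imp_dual_cone[of \<rho> \<gamma>] \<rho>(1) by blast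
    have "restrict \<omega> ?S (F i) \<le> complex_of_real (f i)" if "i \<in> {1..m}" for i
      using \<rho>(1) that agree[OF \<omega>, of i] by simp
    then have "restrict \<omega> ?S \<in> ?lhs"
      using \<open>\<omega> \<in> ?D\<close> by blast
    moreover have "z = ?f (restrict \<omega> ?S)"
      using \<rho>(2) agree[OF \<omega>, of 0] by simp
    ultimately show "z \<in> ?f ` ?lhs"
      by blast
  qed
  then show ?thesis
    by (rule arg_cong)
qed

end
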